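(* Let $G, A, B, E$ be the following. $G$ is the set of all functions $f \in \prod_{n \in \mathbb{N}} S_3$ such that $f(n) \in A_3$ fails for at most finitely many $n$, with coordinatewise operation. Let $\tau = (12) \in S_3$; for $n \in \mathbb{N}$ let $a_n \in G$ be given by $a_n(n) = \tau$ and $a_n(m) = e$ for $m \neq n$; let $E = \{f \in G : f(n) \in \{e,\tau\} \text{ for all } n \in \mathbb{N}\}$; let $A = \{a_n : n \in \mathbb{N}\}$; and let $B = B_1 \cup (E \setminus (A \cup \{e\}))$, where $B_1$ is the set of elements of $G$ that take the value $(13)$ or $(23)$ at some one coordinate and the value $e$ at all other coordinates. Then: (1) $G$ is a group and $|G| = 2^{\aleph_0}$; (2) $A \cap B = \varnothing$, and $|A| = |B| = \aleph_0 < |G|$; (3) $W_G(A,B) = E$, so $|W_G(A,B)| = \aleph_0$; (4) any set $X \subset G$ satisfying $e \in X$, $X = X^{-1}$ and $XAX \cap B = \varnothing$ must be $\{e\}$, so $A$ and $B$ are not separable in $G$.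
   Context: $S_3$ is the symmetric group on three letters, $A_3$ its alternating subgroup, and $e$ denotes the identity element (of $S_3$ or of $G$, as appropriate). For disjoint subsets $A, B$ of an infinite group $G$: $A$ and $B$ are separable in $G$ if there exists a subset $X \subset G$ such that (1) $X$ is infinite; (2) $e \in X$; (3) $X = X^{-1}$, i.e. $x \in X \Rightarrow x^{-1} \in X$; (4) $XAX \cap B = \varnothing$, where $XAX = \{x a x' : x, x' \in X,\ a \in A\}$. Moreover $W_G(A,B) := \{u \in G : \{u,u^{-1}\}\, A\, \{u,u^{-1}\} \cap B = \varnothing\}$, i.e. $u \in W_G(A,B)$ if and only if $uAu$, $uAu^{-1}$, $u^{-1}Au$, $u^{-1}Au^{-1}$ are all disjoint from $B$. *)

theory Defs
  imports "HOL-Algebra.Sym_Groups" "HOL-Algebra.Product_Groups"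
begin

unbundle cardinal_syntax

text \<open>
  Separability is used for disjoint subsets \<open>A\<close>, \<open>B\<close> of the carrier of an infinite group.
  These standing assumptions are not conjuncts of the definition, so that the negation of
  \<open>separable\<close> says exactly that no \<open>X\<close> with the four properties exists.
\<close>

definition separable :: "('a, 'b) monoid_scheme \<Rightarrow> 'a set \<Rightarrow> 'a set \<Rightarrow> bool" where
  "separable G A B \<longleftrightarrow>
     (\<exists>X \<subseteq> carrier G. infinite X \<and> \<one>\<^bsub>G\<^esub> \<in> X \<and> X = set_inv\<^bsub>G\<^esub> X
        \<and> (X <#>\<^bsub>G\<^esub> A <#>\<^bsub>G\<^esub> X) \<inter> B = {})"

definition W_set :: "('a, 'b) monoid_scheme \<Rightarrow> 'a set \<Rightarrow> 'a set \<Rightarrow> 'a set" where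
  "W_set G A B =
     {u \<in> carrier G. ({u, inv\<^bsub>G\<^esub> u} <#>\<^bsub>G\<^esub> A <#>\<^bsub>G\<^esub> {u, inv\<^bsub>G\<^esub> u}) \<inter> B = {}}"

text \<open>
  The three letters are \<open>1, 2, 3\<close>, and the product in \<^term>\<open>sym_group 3\<close> is composition of
  functions.
\<close>

definition G_ex :: "(nat \<Rightarrow> nat \<Rightarrow> nat) monoid" where
  "G_ex = (product_group UNIV (\<lambda>_. sym_group 3))
     \<lparr>carrier := {f \<in> carrier (product_group UNIV (\<lambda>_. sym_group 3)).
                   finite {n. f n \<notin> carrier (alt_group 3)}}\<rparr>"

definition \<tau> :: "nat \<Rightarrow> nat" where
  "\<tau> = transpose 1 2"

definition a_ex :: "nat \<Rightarrow> nat \<Rightarrow> nat \<Rightarrow> nat" where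
  "a_ex n = (\<lambda>m. if m = n then \<tau> else \<one>\<^bsub>sym_group 3\<^esub>)"

definition E_ex :: "(nat \<Rightarrow> nat \<Rightarrow> nat) set" where
  "E_ex = {f \<in> carrier G_ex. \<forall>n. f n \<in> {\<one>\<^bsub>sym_group 3\<^esub>, \<tau>}}"

definition A_ex :: "(nat \<Rightarrow> nat \<Rightarrow> nat) set" where
  "A_ex = range a_ex"

definition B1_ex :: "(nat \<Rightarrow> nat \<Rightarrow> nat) set" where
  "B1_ex = {f \<in> carrier G_ex.
     \<exists>n. f n \<in> {transpose 1 3, transpose 2 3} \<and> (\<forall>m. m \<noteq> n \<longrightarrow> f m = \<one>\<^bsub>sym_group 3\<^esub>)}"

definition B_ex :: "(nat \<Rightarrow> nat \<Rightarrow> nat) set" where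
  "B_ex = B1_ex \<union> (E_ex - (A_ex \<union> {\<one>\<^bsub>G_ex\<^esub>}))"

lemma a_ex_in_carrier: "a_ex n \<in> carrier G_ex"
proof -
  have t: "\<tau> permutes {1..3}"
    unfolding \<tau>_def by (rule permutes_swap_id) auto
  have "{m. a_ex n m \<notin> carrier (alt_group 3)} \<subseteq> {n}"
    by (auto simp: a_ex_def sym_group_one alt_group_carrier permutes_id simp flip: id_def)
  then have "finite {m. a_ex n m \<notin> carrier (alt_group 3)}"
    by (rule finite_subset) simp
  moreover have "a_ex n m \<in> carrier (sym_group 3)" for m
    using t by (auto simp: a_ex_def sym_group_one sym_group_carrier permutes_id)
  ultimately show ?thesis
    by (simp add: G_ex_def PiE_UNIV_domain)
qed

lemma A_ex_subset: "A_ex \<subseteq> carrier G_ex"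
  using a_ex_in_carrier by (auto simp: A_ex_def)

lemma B_ex_subset: "B_ex \<subseteq> carrier G_ex"
  by (auto simp: B_ex_def B1_ex_def E_ex_def)

end

theory Submission
  imports Defs "HOL-Library.Countable_Set_Type"
begin

text \<open>
  Everything rests on one fact about \<open>S\<^sub>3\<close>: the centralizer of \<open>\<tau>\<close> is \<open>{e, \<tau>}\<close>, and conjugating
  \<open>\<tau>\<close> by any other permutation yields one of the two remaining transpositions. Hence, if a
  coordinate \<open>u(n)\<close> of \<open>u\<close> lies outside \<open>{e, \<tau>}\<close>, then \<open>u a\<^sub>n u\<^sup>-\<^sup>1\<close> lies in \<open>B\<^sub>1\<close>, which excludes \<open>u\<close>
  from \<open>W(A, B)\<close>. Conversely, \<open>E\<close> is an abelian group of exponent two, so for \<open>u \<in> E\<close> all four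
  products \<open>u\<^sup>\<plusminus> a u\<^sup>\<plusminus>\<close> equal \<open>a\<close>, and \<open>A\<close> misses \<open>B\<close>. Thus \<open>W(A, B) = E\<close>.

  A symmetric set \<open>X\<close> with \<open>XAX \<inter> B = {}\<close> is contained in \<open>W(A, B) = E\<close>. Were there an \<open>x \<noteq> e\<close>
  in \<open>X\<close>, then \<open>x\<close> would have finite nonempty support, because \<open>\<tau>\<close> is odd; for \<open>n\<close> outside that
  support, \<open>x a\<^sub>n e\<close> is an element of \<open>E\<close> with at least two nontrivial coordinates and hence lies
  in \<open>B\<close>. So \<open>W(A, B)\<close> can be infinite although only the trivial \<open>X\<close> works.

  As for the cardinalities, \<open>G\<close> contains every sequence with values in \<open>A\<^sub>3\<close>, so it has
  \<open>2\<close> to the \<open>\<aleph>\<^sub>0\<close> elements, while all elements of \<open>A\<close>, \<open>B\<close> and \<open>E\<close> have finite support, so these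
  sets are countable.
\<close>

section \<open>The group, coordinatewise\<close>

lemma carrier_G_ex:
  "f \<in> carrier G_ex \<longleftrightarrow> (\<forall>n. f n permutes {1..3}) \<and> finite {n. \<not> evenperm (f n)}"
proof -
  have "{n. f n \<notin> carrier (alt_group 3)} = {n. \<not> evenperm (f n)}" if "\<forall>n. f n permutes {1..3}"
    using that by (simp add: alt_group_carrier)
  moreover have "f \<in> UNIV \<rightarrow> carrier (sym_group 3) \<longleftrightarrow> (\<forall>n. f n permutes {1..3})"
    by (simp add: Pi_iff sym_group_carrier)
  ultimately show ?thesis
    by (auto simp: G_ex_def PiE_UNIV_domain simp del: One_nat_def)
qed

lemma subgroup_G_ex:
  "subgroup (carrier G_ex) (product_group UNIV (\<lambda>_. sym_group 3))"
proof -
  let ?P = "product_group UNIV (\<lambda>_. sym_group 3) :: (nat \<Rightarrow> nat \<Rightarrow> nat) monoid"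
  interpret P: group ?P
    by (simp add: sym_group_is_group)
  have inv: "inv\<^bsub>?P\<^esub> f = (\<lambda>n. inv' (f n))" if "f \<in> carrier G_ex" for f
    using that
    by (subst inv_product_group)
      (auto simp: carrier_G_ex sym_group_is_group PiE_UNIV_domain sym_group_carrier)
  show ?thesis
  proof (rule P.subgroupI)
    show "carrier G_ex \<subseteq> carrier ?P"
      by (auto simp: G_ex_def)
    show "carrier G_ex \<noteq> {}"
      using a_ex_in_carrier by blast
    show "inv\<^bsub>?P\<^esub> f \<in> carrier G_ex" if f: "f \<in> carrier G_ex" for f
    proof -
      have "permutation (f n)" for n
        using f by (meson carrier_G_ex finite_atLeastAtMost permutation_permutes)
      then show ?thesis
        using f by (simp add: inv[OF f] carrier_G_ex permutes_inv evenperm_inv)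
    qed
    show "f \<otimes>\<^bsub>?P\<^esub> g \<in> carrier G_ex" if f: "f \<in> carrier G_ex" and g: "g \<in> carrier G_ex" for f g
    proof -
      have p: "permutation (f n)" "permutation (g n)" for n
        using f g by (meson carrier_G_ex finite_atLeastAtMost permutation_permutes)+
      have "{n. \<not> evenperm (f n \<circ> g n)} \<subseteq> {n. \<not> evenperm (f n)} \<union> {n. \<not> evenperm (g n)}"
        using p by (auto simp: evenperm_comp)
      then have "finite {n. \<not> evenperm (f n \<circ> g n)}"
        by (rule finite_subset) (use f g in \<open>simp add: carrier_G_ex\<close>)
      then show ?thesis
        using f g by (simp add: carrier_G_ex sym_group_mult permutes_compose)
    qed
  qed
qed

lemma group_G_ex: "group G_ex"
proof -
  have "group (product_group UNIV (\<lambda>_. sym_group 3) :: (nat \<Rightarrow> nat \<Rightarrow> nat) monoid)"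
    by (simp add: sym_group_is_group)
  from subgroup.subgroup_is_group[OF subgroup_G_ex this] show ?thesis
    by (simp add: G_ex_def)
qed

interpretation G: group G_ex
  by (rule group_G_ex)

lemma one_G_ex: "\<one>\<^bsub>G_ex\<^esub> = (\<lambda>n. id)"
  by (simp add: G_ex_def sym_group_one restrict_def)

lemma mult_G_ex: "f \<otimes>\<^bsub>G_ex\<^esub> g = (\<lambda>n. f n \<circ> g n)"
  by (simp add: G_ex_def sym_group_mult restrict_def)

lemma inv_G_ex:
  assumes "f \<in> carrier G_ex"
  shows "inv\<^bsub>G_ex\<^esub> f = (\<lambda>n. inv' (f n))"
proof (rule ext)
  fix n
  have "inv\<^bsub>G_ex\<^esub> f \<otimes>\<^bsub>G_ex\<^esub> f = \<one>\<^bsub>G_ex\<^esub>"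
    using assms by simp
  then have "(inv\<^bsub>G_ex\<^esub> f) n \<circ> f n = id"
    by (metis mult_G_ex one_G_ex)
  moreover have "bij (f n)"
    using assms by (meson carrier_G_ex permutes_bij)
  ultimately show "(inv\<^bsub>G_ex\<^esub> f) n = inv' (f n)"
    by (metis bij_is_surj comp_assoc comp_id id_comp surj_iff)
qed

lemma a_ex_apply: "a_ex n m = (if m = n then \<tau> else id)"
  by (simp add: a_ex_def sym_group_one)

lemma tau_neq_id: "\<tau> \<noteq> id"
  by (simp add: \<tau>_def transpose_eq_id_iff)

lemma inj_a_ex: "inj a_ex"
proof (rule injI)
  fix m n assume "a_ex m = a_ex n"
  then have "a_ex m m = a_ex n m"
    by simp
  then show "m = n"
    using tau_neq_id by (simp add: a_ex_apply split: if_splits)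
qed

section \<open>Conjugates of the transposition\<close>

lemma tau_comp_tau: "\<tau> \<circ> \<tau> = id"
  by (simp add: \<tau>_def)

lemma not_evenperm_tau: "\<not> evenperm \<tau>"
  by (simp add: \<tau>_def evenperm_swap)

text \<open>
  The subgroup \<open>{e, \<tau>}\<close> is both the centralizer of \<open>\<tau>\<close> and the stabilizer of the letter \<open>3\<close>; the
  second description is the one that can be read off a conjugate of \<open>\<tau>\<close> directly.
\<close>

lemma permutes_3_fixing_3:
  assumes "p permutes {1..3::nat}" and "p 3 = 3"
  shows "p = id \<or> p = \<tau>"
proof -
  have "p permutes {1, 2}"
  proof (rule permutes_superset[OF assms(1)])
    fix x :: nat assume "x \<in> {1..3} - {1, 2}"
    then have "x = 3" by auto
    with assms(2) show "p x = x" by simp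
  qed
  then show ?thesis
    by (auto simp: permutes_doubleton_iff \<tau>_def)
qed

text \<open>
  The conjugate of \<open>\<tau>\<close> by \<open>p\<close> exchanges \<open>p 1\<close> and \<open>p 2\<close>, so it moves \<open>3\<close> unless \<open>p\<close> fixes \<open>3\<close>.
\<close>

lemma conjugate_tau:
  assumes p: "p permutes {1..3::nat}" and "p \<notin> {id, \<tau>}"
  shows "p \<circ> \<tau> \<circ> inv' p \<in> {transpose 1 3, transpose 2 3}"
proof -
  have bij: "bij p"
    using p by (rule permutes_bij)
  have conj: "p \<circ> \<tau> \<circ> inv' p = transpose (p 1) (p 2)"
  proof -
    have "p \<circ> \<tau> = transpose (p 1) (p 2) \<circ> p"
      using bij by (simp add: \<tau>_def transpose_comp_eq bij_is_inj)
    then have "p \<circ> \<tau> \<circ> inv' p = transpose (p 1) (p 2) \<circ> (p \<circ> inv' p)"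
      by (simp add: comp_assoc)
    then show ?thesis
      by (simp add: permutes_inv_o(1)[OF p])
  qed
  have p3: "p 3 \<noteq> 3"
    using permutes_3_fixing_3 assms by blast
  have im: "p i \<in> {1, 2, 3}" if "i \<in> {1, 2, 3}" for i
    using permutes_in_image[OF p, of i] that by auto
  have "p 1 \<noteq> p 2" "p 1 \<noteq> p 3" "p 2 \<noteq> p 3"
    using bij by (simp_all add: bij_is_inj inj_eq)
  with p3 im[of 1] im[of 2] im[of 3]
  have "(p 1, p 2) \<in> {(1, 3), (3, 1), (2, 3), (3, 2)}"
    by auto
  then show ?thesis
    by (auto simp: conj transpose_commute)
qed

section \<open>The subgroup \<open>E\<close>\<close>

lemma E_ex_iff: "f \<in> E_ex \<longleftrightarrow> f \<in> carrier G_ex \<and> (\<forall>n. f n \<in> {id, \<tau>})"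
  by (simp add: E_ex_def sym_group_one)

lemma a_ex_in_E_ex: "a_ex n \<in> E_ex"
  by (simp add: E_ex_iff a_ex_in_carrier a_ex_apply)

lemma E_ex_mult:
  assumes "f \<in> E_ex" "g \<in> E_ex"
  shows "f \<otimes>\<^bsub>G_ex\<^esub> g \<in> E_ex"
proof -
  have "f n \<circ> g n \<in> {id, \<tau>}" for n
    using assms[unfolded E_ex_iff, THEN conjunct2, rule_format, of n] by (auto simp: tau_comp_tau)
  then show ?thesis
    using assms G.m_closed unfolding E_ex_iff mult_G_ex by blast
qed

lemma E_ex_square:
  assumes "f \<in> E_ex"
  shows "f \<otimes>\<^bsub>G_ex\<^esub> f = \<one>\<^bsub>G_ex\<^esub>"
proof -
  have "f n \<circ> f n = id" for n
    using assms[unfolded E_ex_iff, THEN conjunct2, rule_format, of n] by (auto simp: tau_comp_tau)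
  then show ?thesis
    by (simp add: mult_G_ex one_G_ex)
qed

text \<open>
  \<open>E\<close> is commutative of exponent two. Since its elements are their own inverses, this identity
  settles all four products in the definition of \<open>W(A, B)\<close>.
\<close>

lemma E_ex_sandwich:
  assumes "f \<in> E_ex" "g \<in> E_ex"
  shows "f \<otimes>\<^bsub>G_ex\<^esub> g \<otimes>\<^bsub>G_ex\<^esub> f = g"
proof -
  have "f n \<circ> g n \<circ> f n = g n" for n
    using assms[unfolded E_ex_iff, THEN conjunct2, rule_format, of n] by (auto simp: tau_comp_tau)
  then show ?thesis
    by (simp add: mult_G_ex)
qed

lemma E_ex_finite_support:
  assumes "f \<in> E_ex"
  shows "finite {n. f n \<noteq> id}"
proof -
  have "f n \<noteq> id \<Longrightarrow> f n = \<tau>" for n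
    using assms by (simp add: E_ex_iff) blast
  then have "{n. f n \<noteq> id} \<subseteq> {n. \<not> evenperm (f n)}"
    using not_evenperm_tau by (intro Collect_mono) metis
  moreover have "finite {n. \<not> evenperm (f n)}"
    using assms by (simp add: E_ex_iff carrier_G_ex)
  ultimately show ?thesis
    by (rule finite_subset)
qed

lemma A_ex_B_ex_disjoint: "A_ex \<inter> B_ex = {}"
proof -
  have "a_ex n m \<notin> {transpose 1 3, transpose 2 3}" for n m
  proof -
    have "a_ex n m 3 = 3"
      by (simp add: a_ex_apply \<tau>_def transpose_def)
    moreover have "transpose 1 3 (3::nat) \<noteq> 3" "transpose 2 3 (3::nat) \<noteq> 3"
      by simp_all
    ultimately show ?thesis
      by auto
  qed
  then have "a_ex n \<notin> B1_ex" for n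
    unfolding B1_ex_def by blast
  then show ?thesis
    by (auto simp: A_ex_def B_ex_def)
qed

section \<open>The set \<open>W(A, B)\<close> and symmetric sets\<close>

lemma W_ex_subset_E_ex: "W_set G_ex A_ex B_ex \<subseteq> E_ex"
proof
  fix u assume "u \<in> W_set G_ex A_ex B_ex"
  then have u: "u \<in> carrier G_ex"
    and disj: "({u, inv\<^bsub>G_ex\<^esub> u} <#>\<^bsub>G_ex\<^esub> A_ex <#>\<^bsub>G_ex\<^esub> {u, inv\<^bsub>G_ex\<^esub> u}) \<inter> B_ex = {}"
    by (simp_all add: W_set_def)
  have perm: "u n permutes {1..3}" for n
    using u by (simp add: carrier_G_ex)
  have "u n \<in> {id, \<tau>}" for n
  proof (rule ccontr)
    assume n: "u n \<notin> {id, \<tau>}"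
    define c where "c = u \<otimes>\<^bsub>G_ex\<^esub> a_ex n \<otimes>\<^bsub>G_ex\<^esub> inv\<^bsub>G_ex\<^esub> u"
    have c: "c m = u m \<circ> a_ex n m \<circ> inv' (u m)" for m
      by (simp add: c_def mult_G_ex inv_G_ex[OF u])
    have "c \<in> {u, inv\<^bsub>G_ex\<^esub> u} <#>\<^bsub>G_ex\<^esub> A_ex <#>\<^bsub>G_ex\<^esub> {u, inv\<^bsub>G_ex\<^esub> u}"
      by (auto simp: c_def set_mult_def A_ex_def)
    moreover have "c \<in> B1_ex"
    proof -
      have "c \<in> carrier G_ex"
        using u a_ex_in_carrier by (simp add: c_def)
      moreover have "c n \<in> {transpose 1 3, transpose 2 3}"
        using conjugate_tau[OF perm n] by (simp add: c a_ex_apply)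
      moreover have "c m = id" if "m \<noteq> n" for m
        using that by (simp add: c a_ex_apply permutes_inv_o[OF perm])
      ultimately show ?thesis
        unfolding B1_ex_def sym_group_one by (intro CollectI conjI exI[of _ n] allI impI)
    qed
    ultimately show False
      using disj by (auto simp: B_ex_def)
  qed
  then show "u \<in> E_ex"
    using u by (simp add: E_ex_iff)
qed

lemma E_ex_subset_W_ex: "E_ex \<subseteq> W_set G_ex A_ex B_ex"
proof
  fix u assume E: "u \<in> E_ex"
  then have u: "u \<in> carrier G_ex"
    by (simp add: E_ex_iff)
  have "inv\<^bsub>G_ex\<^esub> u = u"
    using E_ex_square[OF E] u by (simp add: G.inv_equality)
  moreover have "{u} <#>\<^bsub>G_ex\<^esub> A_ex <#>\<^bsub>G_ex\<^esub> {u} \<subseteq> A_ex"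
    using E_ex_sandwich[OF E a_ex_in_E_ex] by (auto simp: set_mult_def A_ex_def)
  ultimately show "u \<in> W_set G_ex A_ex B_ex"
    using u A_ex_B_ex_disjoint by (auto simp: W_set_def)
qed

text \<open>
  Membership in \<open>W(A, B)\<close> tests one element and its inverse at a time. A symmetric set contains
  both, so avoiding \<open>B\<close> as a whole forces every element to pass the test.
\<close>

lemma symmetric_subset_W_set:
  assumes "X \<subseteq> carrier G" "X = set_inv\<^bsub>G\<^esub> X" "(X <#>\<^bsub>G\<^esub> A <#>\<^bsub>G\<^esub> X) \<inter> B = {}"
  shows "X \<subseteq> W_set G A B"
proof
  fix x assume x: "x \<in> X"
  then have "inv\<^bsub>G\<^esub> x \<in> X"
    by (subst assms(2)) (auto simp: SET_INV_def)
  with x have "{x, inv\<^bsub>G\<^esub> x} \<subseteq> X"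
    by simp
  then have "{x, inv\<^bsub>G\<^esub> x} <#>\<^bsub>G\<^esub> A <#>\<^bsub>G\<^esub> {x, inv\<^bsub>G\<^esub> x} \<subseteq> X <#>\<^bsub>G\<^esub> A <#>\<^bsub>G\<^esub> X"
    by (intro mono_set_mult order_refl)
  then show "x \<in> W_set G A B"
    using x assms(1,3) by (auto simp: W_set_def)
qed

text \<open>
  Passing the test one element at a time is weaker than avoiding \<open>B\<close> as a whole: for \<open>x \<in> E\<close> the
  products \<open>x a x\<close> return \<open>a\<close>, but \<open>e \<in> X\<close> also allows the product \<open>x a e\<close>, whose support can be
  made larger than a single coordinate.
\<close>

lemma symmetric_avoiding_trivial:
  assumes X: "X \<subseteq> carrier G_ex" and one: "\<one>\<^bsub>G_ex\<^esub> \<in> X" and sym: "X = set_inv\<^bsub>G_ex\<^esub> X"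
    and disj: "(X <#>\<^bsub>G_ex\<^esub> A_ex <#>\<^bsub>G_ex\<^esub> X) \<inter> B_ex = {}"
  shows "X = {\<one>\<^bsub>G_ex\<^esub>}"
proof -
  have "x = \<one>\<^bsub>G_ex\<^esub>" if x: "x \<in> X" for x
  proof (rule ccontr)
    assume "x \<noteq> \<one>\<^bsub>G_ex\<^esub>"
    then obtain k where k: "x k \<noteq> id"
      unfolding one_G_ex by (meson ext)
    have E: "x \<in> E_ex"
      using symmetric_subset_W_set[OF X sym disj] W_ex_subset_E_ex x by (meson subsetD)
    \<comment> \<open>Any coordinate outside the support will do; on it \<open>a_ex n\<close> adds a second nontrivial value.\<close>
    obtain n where n: "x n = id"
      using ex_new_if_finite[OF infinite_UNIV_nat E_ex_finite_support[OF E]] by auto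
    define y where "y = x \<otimes>\<^bsub>G_ex\<^esub> a_ex n \<otimes>\<^bsub>G_ex\<^esub> \<one>\<^bsub>G_ex\<^esub>"
    have y: "y m = x m \<circ> a_ex n m" for m
      by (simp add: y_def mult_G_ex one_G_ex)
    have kn: "k \<noteq> n"
      using k n by auto
    have yk: "y k \<noteq> id" and yn: "y n \<noteq> id"
      using k n kn tau_neq_id by (simp_all add: y a_ex_apply)
    have "x \<otimes>\<^bsub>G_ex\<^esub> a_ex n \<in> E_ex"
      using E a_ex_in_E_ex by (rule E_ex_mult)
    then have "y \<in> E_ex"
      unfolding y_def by (subst G.r_one) (simp_all add: E_ex_iff)
    moreover have "y \<notin> A_ex"
    proof
      assume "y \<in> A_ex"
      then obtain m where "y = a_ex m"
        by (auto simp: A_ex_def)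
      with yk yn have "k = m" "n = m"
        by (simp_all add: a_ex_apply split: if_splits)
      with kn show False
        by simp
    qed
    moreover have "y \<noteq> \<one>\<^bsub>G_ex\<^esub>"
      using yk by (metis one_G_ex)
    ultimately have "y \<in> B_ex"
      by (simp add: B_ex_def)
    moreover have "y \<in> X <#>\<^bsub>G_ex\<^esub> A_ex <#>\<^bsub>G_ex\<^esub> X"
      unfolding y_def set_mult_def A_ex_def using x one by blast
    ultimately show False
      using disj by blast
  qed
  then have "X \<subseteq> {\<one>\<^bsub>G_ex\<^esub>}"
    by (intro subsetI) (simp only: singleton_iff)
  then show ?thesis
    using one by blast
qed

section \<open>Cardinalities\<close>

lemma card_of_eq_natLeq:
  assumes "countable S" "infinite S"
  shows "|S| =o natLeq"
proof -
  have "natLeq \<le>o |S|"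
    using infinite_iff_natLeq_ordLeq assms(2) by blast
  then show ?thesis
    using assms(1) unfolding countable_card_le_natLeq ordIso_iff_ordLeq by blast
qed

lemma ctwo_cexp_natLeq: "|UNIV :: nat set set| =o ctwo ^c natLeq"
  using card_of_Pow_Func[of "UNIV :: nat set"]
  by (simp add: cexp_def ctwo_def Field_natLeq Field_card_of)

text \<open>
  The upper bound identifies a sequence of functions with its graph in \<open>\<nat> \<times> \<nat> \<times> \<nat>\<close>; for the
  lower bound, a set of naturals is coded by a sequence of identities and copies of one 3-cycle.
  Being even, the 3-cycle may occur at infinitely many coordinates.
\<close>

lemma card_of_G_ex: "|carrier G_ex| =o ctwo ^c natLeq"
proof -
  define graph :: "(nat \<Rightarrow> nat \<Rightarrow> nat) \<Rightarrow> (nat \<times> nat \<times> nat) set"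
    where "graph f = {(n, i, j). f n i = j}" for f
  have "inj graph"
    by (rule injI) (auto simp: graph_def fun_eq_iff set_eq_iff)
  then have "inj (image to_nat \<circ> graph)"
    by (intro inj_compose inj_on_image) auto
  then have le: "|carrier G_ex| \<le>o |UNIV :: nat set set|"
    by (intro card_of_ordLeqI[where f = "image to_nat \<circ> graph"]) (auto intro: inj_on_subset)
  define c :: "nat \<Rightarrow> nat" where "c = transpose 1 2 \<circ> transpose 2 3"
  define code :: "nat set \<Rightarrow> nat \<Rightarrow> nat \<Rightarrow> nat"
    where "code S n = (if n \<in> S then c else id)" for S n
  have "c permutes {1..3}"
    unfolding c_def by (intro permutes_compose permutes_swap_id) auto
  moreover have "evenperm c"
    by (simp add: c_def evenperm_comp permutation_swap_id evenperm_swap)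
  ultimately have carrier: "code S \<in> carrier G_ex" for S
    by (auto simp: carrier_G_ex code_def permutes_id evenperm_id)
  have "c 3 \<noteq> 3"
    by (simp add: c_def transpose_def)
  then have "c \<noteq> id"
    by auto
  have "inj code"
  proof (rule injI)
    fix S T assume eq: "code S = code T"
    have "n \<in> S \<longleftrightarrow> n \<in> T" for n
      using fun_cong[OF eq, of n] \<open>c \<noteq> id\<close> by (auto simp: code_def split: if_splits)
    then show "S = T"
      by blast
  qed
  with carrier have ge: "|UNIV :: nat set set| \<le>o |carrier G_ex|"
    by (intro card_of_ordLeqI[of code]) auto
  from le ge have "|carrier G_ex| =o |UNIV :: nat set set|"
    by (simp add: ordIso_iff_ordLeq)
  then show ?thesis
    using ctwo_cexp_natLeq by (rule ordIso_transitive)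
qed

lemma natLeq_less_card_of_G_ex: "natLeq <o |carrier G_ex|"
proof -
  have "natLeq =o |UNIV :: nat set|"
    using card_of_nat by (rule ordIso_symmetric)
  also have "|UNIV :: nat set| <o |UNIV :: nat set set|"
    using card_of_Pow[of "UNIV :: nat set"] by simp
  also have "|UNIV :: nat set set| =o |carrier G_ex|"
    using ctwo_cexp_natLeq ordIso_symmetric[OF card_of_G_ex] by (rule ordIso_transitive)
  finally show ?thesis .
qed

text \<open>
  A finitely supported sequence is determined by the finite restriction of its graph to the support.
\<close>

lemma countable_finite_support:
  assumes "countable P"
  shows "countable {f :: nat \<Rightarrow> 'a. (\<forall>n. f n \<in> P) \<and> finite {n. f n \<noteq> z}}" (is "countable ?F")
proof -
  define graph where "graph f = (\<lambda>n. (n, f n)) ` {n. f n \<noteq> z}" for f :: "nat \<Rightarrow> 'a"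
  have "graph ` ?F \<subseteq> Fpow (UNIV \<times> P)"
    by (auto simp: graph_def Fpow_def)
  moreover have "countable (Fpow ((UNIV :: nat set) \<times> P))"
    using assms by (intro countable_Fpow countable_SIGMA) auto
  ultimately have "countable (graph ` ?F)"
    by (rule countable_subset)
  moreover have "inj graph"
  proof (rule injI)
    fix f g assume "graph f = graph g"
    moreover have "(n, x) \<in> graph h \<longleftrightarrow> h n = x \<and> x \<noteq> z" for h n x
      by (auto simp: graph_def)
    ultimately have "f n = x \<and> x \<noteq> z \<longleftrightarrow> g n = x \<and> x \<noteq> z" for n x
      by metis
    then show "f = g"
      by (metis ext)
  qed
  ultimately show ?thesis
    by (meson countable_image_inj_on inj_on_subset subset_UNIV)
qed

lemma countable_E_ex: "countable E_ex"
  by (rule countable_subset[OF _ countable_finite_support[of "{id, \<tau>}" id]])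
    (auto simp: E_ex_iff intro: E_ex_finite_support)

lemma countable_B_ex: "countable B_ex"
proof -
  have "finite {n. f n \<noteq> id}" if f: "f \<in> B1_ex" for f
  proof -
    obtain n where "\<forall>m. m \<noteq> n \<longrightarrow> f m = id"
      using f by (auto simp: B1_ex_def sym_group_one)
    then have "{m. f m \<noteq> id} \<subseteq> {n}"
      by auto
    then show ?thesis
      by (rule finite_subset) simp
  qed
  then have "B1_ex \<subseteq> {f. (\<forall>n. f n \<in> {p. p permutes {1..3}}) \<and> finite {n. f n \<noteq> id}}"
    by (auto simp: B1_ex_def carrier_G_ex)
  moreover have "countable {p. p permutes {1..3::nat}}"
    by (intro countable_finite finite_permutations) simp
  ultimately have "countable B1_ex"
    by (rule countable_subset[OF _ countable_finite_support])
  then show ?thesis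
    using countable_E_ex by (simp add: B_ex_def)
qed

lemma infinite_A_ex: "infinite A_ex"
  using inj_a_ex by (simp add: A_ex_def range_inj_infinite)

text \<open>The products \<open>a\<^sub>0 a\<^sub>n\<close> with \<open>n > 0\<close> have two nontrivial coordinates, so they belong to \<open>B\<close>.\<close>

lemma infinite_B_ex: "infinite B_ex"
proof -
  let ?b = "\<lambda>n. a_ex 0 \<otimes>\<^bsub>G_ex\<^esub> a_ex (Suc n)"
  have "inj ?b"
    using inj_a_ex by (auto intro!: injI simp: a_ex_in_carrier inj_eq)
  then have "infinite (range ?b)"
    by (rule range_inj_infinite)
  moreover have "?b n \<in> B_ex" for n
  proof -
    have v: "?b n 0 = \<tau>" "?b n (Suc n) = \<tau>"
      by (simp_all add: mult_G_ex a_ex_apply)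
    have "?b n \<noteq> a_ex m" for m
    proof
      assume "?b n = a_ex m"
      with v have "a_ex m 0 = \<tau>" "a_ex m (Suc n) = \<tau>"
        by simp_all
      then show False
        using tau_neq_id by (auto simp: a_ex_apply split: if_splits)
    qed
    moreover have "?b n \<noteq> \<one>\<^bsub>G_ex\<^esub>"
      using v(1) tau_neq_id by (metis one_G_ex)
    ultimately show ?thesis
      using E_ex_mult[OF a_ex_in_E_ex a_ex_in_E_ex] by (auto simp: B_ex_def A_ex_def)
  qed
  ultimately show ?thesis
    by (meson image_subsetI infinite_super)
qed

section \<open>The example\<close>

theorem proposition6p1:
  shows "(group G_ex \<and> |carrier G_ex| =o ctwo ^c natLeq)
    \<and> (A_ex \<inter> B_ex = {}
        \<and> |A_ex| =o |B_ex| \<and> |B_ex| =o natLeq \<and> natLeq <o |carrier G_ex| )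
    \<and> (W_set G_ex A_ex B_ex = E_ex \<and> |W_set G_ex A_ex B_ex| =o natLeq)
    \<and> ((\<forall>X \<subseteq> carrier G_ex. \<one>\<^bsub>G_ex\<^esub> \<in> X \<and> X = set_inv\<^bsub>G_ex\<^esub> X
              \<and> (X <#>\<^bsub>G_ex\<^esub> A_ex <#>\<^bsub>G_ex\<^esub> X) \<inter> B_ex = {}
            \<longrightarrow> X = {\<one>\<^bsub>G_ex\<^esub>})
        \<and> \<not> separable G_ex A_ex B_ex)"
proof (intro conjI)
  show "group G_ex"
    by (rule group_G_ex)
  show "|carrier G_ex| =o ctwo ^c natLeq"
    by (rule card_of_G_ex)
  show "A_ex \<inter> B_ex = {}"
    by (rule A_ex_B_ex_disjoint)
  have A: "|A_ex| =o natLeq"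
    by (rule card_of_eq_natLeq[OF _ infinite_A_ex]) (simp add: A_ex_def)
  show B: "|B_ex| =o natLeq"
    by (rule card_of_eq_natLeq[OF countable_B_ex infinite_B_ex])
  show "|A_ex| =o |B_ex|"
    using A ordIso_symmetric[OF B] by (rule ordIso_transitive)
  show "natLeq <o |carrier G_ex|"
    by (rule natLeq_less_card_of_G_ex)
  show W: "W_set G_ex A_ex B_ex = E_ex"
    using W_ex_subset_E_ex E_ex_subset_W_ex by (rule subset_antisym)
  have "A_ex \<subseteq> E_ex"
    by (auto simp: A_ex_def a_ex_in_E_ex)
  then have "infinite E_ex"
    using infinite_A_ex by (rule infinite_super)
  then show "|W_set G_ex A_ex B_ex| =o natLeq"
    unfolding W by (rule card_of_eq_natLeq[OF countable_E_ex])
  show trivial: "\<forall>X \<subseteq> carrier G_ex. \<one>\<^bsub>G_ex\<^esub> \<in> X \<and> X = set_inv\<^bsub>G_ex\<^esub> X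
              \<and> (X <#>\<^bsub>G_ex\<^esub> A_ex <#>\<^bsub>G_ex\<^esub> X) \<inter> B_ex = {}
            \<longrightarrow> X = {\<one>\<^bsub>G_ex\<^esub>}"
    using symmetric_avoiding_trivial by blast
  show "\<not> separable G_ex A_ex B_ex"
  proof
    assume "separable G_ex A_ex B_ex"
    then obtain X where "X \<subseteq> carrier G_ex" "infinite X" "\<one>\<^bsub>G_ex\<^esub> \<in> X" "X = set_inv\<^bsub>G_ex\<^esub> X"
      "(X <#>\<^bsub>G_ex\<^esub> A_ex <#>\<^bsub>G_ex\<^esub> X) \<inter> B_ex = {}"
      unfolding separable_def by blast
    then have "X = {\<one>\<^bsub>G_ex\<^esub>}"
      using symmetric_avoiding_trivial by blast
    with \<open>infinite X\<close> show False
      by (metis finite.emptyI finite_insert)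
  qed
qed

end
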